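(* Let $\mathfrak A$ be an HTG and $\mathcal Q$ be a $\sigma$-ring. Then $\mathcal M(\mathcal Q,\mathfrak A)$ is a group. For every $\mu\in\mathcal M(\mathcal Q,\mathfrak A)$, the inverse $-\mu$ of $\mu$ in this group is the pointwise minus of $\mu$, i.e. the map $A\mapsto-\mu(A)$ on $D_\mu$.
   Context: Monoids and groups are Abelian and written additively. An HTM is a monoid with a Hausdorff topology making addition continuous; an HTG is a group with a Hausdorff topology making addition and inversion continuous. For a map $f$, $D_f$ denotes its domain. "Countable" includes finite and empty. A ring is a nonempty set $\mathcal Q$ of sets such that $A\cup B\in\mathcal Q$ and $A\setminus B\in\mathcal Q$ for all $A,B\in\mathcal Q$. A $\delta$-ring is a ring closed under intersections of nonempty countable families; a $\sigma$-ring is a ring closed under countable unions. For a set of sets $\mathcal K$, $\sigma(\mathcal K)$ is the smallest $\sigma$-ring containing $\mathcal K$. A family $\mathbf A\colon I\to\mathcal Q$ is a partition of $A$ (into elements of $\mathcal Q$) if $\mathbf A(i)\cap\mathbf A(j)=\varnothing$ for $i\ne j$ and $\bigcup_{i\in I}\mathbf A(i)=A$ (members may be empty and $I$ may be empty); it is countable if $I$ is countable. A family $f\colon I\to\mathfrak A$ in an HTM is summable in $\mathfrak A$ if the net $J\mapsto\sum_{i\in J}f(i)$ over the finite subsets $J\subset I$, directed by inclusion, converges in $\mathfrak A$; its limit is denoted $\sum f$. An $\mathfrak A$-valued premeasure is a map $\mu\colon D_\mu\to\mathfrak A$ whose domain $D_\mu$ is a $\delta$-ring and such that for every $A\in D_\mu$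 and every countable partition $\mathbf A$ of $A$ into elements of $D_\mu$, the family $\mu\circ\mathbf A$ is summable in $\mathfrak A$ and $\mu(A)=\sum\mu\circ\mathbf A$. The host $\sigma$-ring of a map $\mu$ is $\mathscr H[\mu]=\sigma(D_\mu)$. Maps $\mu,\nu$ are similar, $\mu\asymp\nu$, if $\mathscr H[\mu]=\mathscr H[\nu]$ and $\mu,\nu$ coincide on $D_\mu\cap D_\nu$. An $\mathfrak A$-valued measure is an $\mathfrak A$-valued premeasure $\mu$ which is an extension of every $\mathfrak A$-valued premeasure $\nu$ with $\nu\asymp\mu$. For every $\mathfrak A$-valued premeasure $\mu$ there is a unique $\mathfrak A$-valued measure similar to $\mu$; it is called the measure associated with $\mu$ and denoted $[\![\mu]\!]_{\mathfrak A}$. For an HTM $\mathfrak A$ and a $\sigma$-ring $\mathcal Q$, $\mathcal M(\mathcal Q,\mathfrak A)$ is the set of all $\mathfrak A$-valued measures $\mu$ with $\mathscr H[\mu]=\mathcal Q$, endowed with the addition $\mu+\nu=[\![\mu\dotplus\nu]\!]_{\mathfrak A}$, where $\mu\dotplus\nu$ is the pointwise sum of $\mu$ and $\nu$ defined on $D_\mu\cap D_\nu$ (this is an $\mathfrak A$-valued premeasure with host $\sigma$-ring $\mathcal Q$). *)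

theory Defs
  imports "HOL-Analysis.Infinite_Sum" "HOL-Analysis.Sigma_Algebra" "HOL-Algebra.Group"
begin

text \<open>Rings of sets have no ambient space here, so \<^const>\<open>ring_of_sets\<close> is used with the trivial
  ambient set \<^term>\<open>UNIV\<close>.\<close>

lemma ring_of_sets_UNIV_iff:
  "ring_of_sets UNIV Q \<longleftrightarrow> Q \<noteq> {} \<and> (\<forall>A\<in>Q. \<forall>B\<in>Q. A \<union> B \<in> Q \<and> A - B \<in> Q)"
proof
  assume "Q \<noteq> {} \<and> (\<forall>A\<in>Q. \<forall>B\<in>Q. A \<union> B \<in> Q \<and> A - B \<in> Q)"
  moreover from this have "{} \<in> Q" by (metis Diff_cancel ex_in_conv)
  ultimately show "ring_of_sets UNIV Q" by (auto simp: ring_of_sets_iff)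
qed (auto simp: ring_of_sets_iff)

definition delta_ring :: "'x set set \<Rightarrow> bool" where
  "delta_ring Q \<longleftrightarrow> ring_of_sets UNIV Q \<and>
     (\<forall>F. F \<noteq> {} \<and> countable F \<and> F \<subseteq> Q \<longrightarrow> \<Inter>F \<in> Q)"

definition sigma_ring :: "'x set set \<Rightarrow> bool" where
  "sigma_ring Q \<longleftrightarrow> ring_of_sets UNIV Q \<and>
     (\<forall>F. countable F \<and> F \<subseteq> Q \<longrightarrow> \<Union>F \<in> Q)"

definition partition_into :: "'x set set \<Rightarrow> 'x set \<Rightarrow> 'i set \<Rightarrow> ('i \<Rightarrow> 'x set) \<Rightarrow> bool" where
  "partition_into Q A I P \<longleftrightarrow> P ` I \<subseteq> Q \<and> disjoint_family_on P I \<and> (\<Union>i\<in>I. P i) = A"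

text \<open>A map defined on a set of sets is a partial function \<^typ>\<open>'x set \<rightharpoonup> 'a\<close>; its domain is
  \<^term>\<open>dom \<mu>\<close>, and ``\<open>\<mu>\<close> extends \<open>\<nu>\<close>'' is \<^term>\<open>\<nu> \<subseteq>\<^sub>m \<mu>\<close>.

  Countable index sets are taken to be subsets of \<^typ>\<open>nat\<close> (finite and empty ones included), because
  a definition cannot quantify over index types. This loses no generality: see
  \<open>premeasure_has_sum\<close> below.\<close>

definition premeasure :: "('x set \<rightharpoonup> 'a::{topological_comm_monoid_add, t2_space}) \<Rightarrow> bool" where
  "premeasure \<mu> \<longleftrightarrow> delta_ring (dom \<mu>) \<and>
     (\<forall>A\<in>dom \<mu>. \<forall>(I::nat set) P. partition_into (dom \<mu>) A I P \<longrightarrow>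
        ((\<lambda>i. the (\<mu> (P i))) has_sum the (\<mu> A)) I)"

lemma premeasure_has_sum:
  assumes "premeasure \<mu>" "A \<in> dom \<mu>" "countable I" "partition_into (dom \<mu>) A I P"
  shows "((\<lambda>i. the (\<mu> (P i))) has_sum the (\<mu> A)) I"
proof -
  let ?J = "to_nat_on I ` I"
  have bij: "bij_betw (from_nat_into I) ?J I"
    using assms(3) by (auto simp: bij_betw_def inj_on_def image_image)
  have "partition_into (dom \<mu>) A ?J (P \<circ> from_nat_into I)"
    using assms(3,4) by (auto simp: partition_into_def disjoint_family_on_def)
  then have "((\<lambda>i. the (\<mu> ((P \<circ> from_nat_into I) i))) has_sum the (\<mu> A)) ?J"
    using assms(1,2) unfolding premeasure_def by blast
  then show ?thesis
    using has_sum_reindex_bij_betw[OF bij, of "\<lambda>i. the (\<mu> (P i))"] by simp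
qed

definition host :: "('x set \<rightharpoonup> 'a) \<Rightarrow> 'x set set" where
  "host \<mu> = sigma_ring hull (dom \<mu>)"

definition similar :: "('x set \<rightharpoonup> 'a) \<Rightarrow> ('x set \<rightharpoonup> 'a) \<Rightarrow> bool" where
  "similar \<mu> \<nu> \<longleftrightarrow> host \<mu> = host \<nu> \<and> (\<forall>A \<in> dom \<mu> \<inter> dom \<nu>. \<mu> A = \<nu> A)"

definition ring_measure :: "('x set \<rightharpoonup> 'a::{topological_comm_monoid_add, t2_space}) \<Rightarrow> bool" where
  "ring_measure \<mu> \<longleftrightarrow> premeasure \<mu> \<and> (\<forall>\<nu>. premeasure \<nu> \<and> similar \<nu> \<mu> \<longrightarrow> \<nu> \<subseteq>\<^sub>m \<mu>)"

definition associated_measure ::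
    "('x set \<rightharpoonup> 'a::{topological_comm_monoid_add, t2_space}) \<Rightarrow> ('x set \<rightharpoonup> 'a)" where
  "associated_measure \<mu> = (THE \<rho>. ring_measure \<rho> \<and> similar \<rho> \<mu>)"

definition pointwise_plus ::
    "('x set \<rightharpoonup> 'a::plus) \<Rightarrow> ('x set \<rightharpoonup> 'a) \<Rightarrow> ('x set \<rightharpoonup> 'a)" where
  "pointwise_plus \<mu> \<nu> =
     (\<lambda>A. if A \<in> dom \<mu> \<inter> dom \<nu> then Some (the (\<mu> A) + the (\<nu> A)) else None)"

definition pointwise_minus :: "('x set \<rightharpoonup> 'a::uminus) \<Rightarrow> ('x set \<rightharpoonup> 'a)" where
  "pointwise_minus \<mu> = (\<lambda>A. if A \<in> dom \<mu> then Some (- the (\<mu> A)) else None)"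

text \<open>The additive structure is expressed by a multiplicative \<^theory>\<open>HOL-Algebra.Group\<close> record.
  Such a record has to name its neutral element; here it is the zero map defined on all of \<open>Q\<close>.\<close>

definition measure_monoid ::
    "'x set set \<Rightarrow> ('x set \<rightharpoonup> 'a::{topological_comm_monoid_add, t2_space}) monoid" where
  "measure_monoid Q =
     \<lparr>carrier = {\<mu>. ring_measure \<mu> \<and> host \<mu> = Q},
      mult = (\<lambda>\<mu> \<nu>. associated_measure (pointwise_plus \<mu> \<nu>)),
      one = (\<lambda>A. if A \<in> Q then Some 0 else None)\<rparr>"

end

theory Submission
  imports Defs
begin

text \<open>The domain of a premeasure is an ideal of its host \<open>\<sigma>\<close>-ring, and every member of the host
  is a countable disjoint union of members of the domain. Hence the measure associated with \<open>\<mu>\<close>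
  is given by \<open>\<mu>\<close>-sums over partitions, on those sets of the host all of whose measurable subsets
  have a \<open>\<mu>\<close>-sum independent of the partition; every premeasure similar to \<open>\<mu>\<close> is a
  restriction of it. So similar premeasures have the same associated measure, and the group laws,
  which hold pointwise on a common domain up to similarity, carry over.\<close>

subsection \<open>Iterated sums in topological groups\<close>

text \<open>Induction on the set of outer indices, one fibre at a time. It provides finite partial
  sums of \<open>f\<close> that approximate a finite sum of inner limits.\<close>

lemma has_sum_Sigma_finite:
  fixes f :: "'i \<times> 'j \<Rightarrow> 'a::topological_comm_monoid_add"
  assumes "finite A" "\<And>x. x \<in> A \<Longrightarrow> ((\<lambda>y. f (x, y)) has_sum g x) (B x)"
  shows "(f has_sum sum g A) (Sigma A B)"
  using assms
proof (induction A)
  case (insert x A)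
  have "((f \<circ> Pair x) has_sum g x) (B x)"
    using insert.prems by (simp add: comp_def)
  then have "(f has_sum g x) (Pair x ` B x)"
    by (simp add: has_sum_reindex inj_on_def)
  then have "(f has_sum (g x + sum g A)) (Pair x ` B x \<union> Sigma A B)"
    using insert.IH insert.prems \<open>x \<notin> A\<close> by (intro has_sum_Un_disjoint) auto
  moreover have "Pair x ` B x \<union> Sigma A B = Sigma (insert x A) B"
    by auto
  ultimately show ?case
    using insert by simp
qed simp

text \<open>The library versions require a regular or a uniform space. Every topological group is regular, but
  this is not available as a class instance, so the argument is inlined: a large finite partial sum
  is close both to \<open>s\<close> and to the finite sum of the inner limits.\<close>

lemma has_sum_Sigma_topological_group:
  fixes f :: "'i \<times> 'j \<Rightarrow> 'a::topological_ab_group_add"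
  assumes sumf: "(f has_sum s) (Sigma A B)"
    and inner: "\<And>x. x \<in> A \<Longrightarrow> ((\<lambda>y. f (x, y)) has_sum g x) (B x)"
  shows "(g has_sum s) A"
  unfolding has_sum_def
proof (rule topological_tendstoI)
  fix X :: "'a set" assume X: "open X" "s \<in> X"
  \<comment> \<open>Continuity of \<open>s + u - v\<close> at \<open>u = v = 0\<close> yields a
    neighbourhood \<open>W\<close> of \<open>0\<close>, given as a predicate, with
    \<open>s + W - W\<close> inside \<open>X\<close>. It takes the place of a uniform
    structure.\<close>
  have "((\<lambda>p. s + fst p - snd p) \<longlongrightarrow> s + 0 - 0) (nhds (0::'a) \<times>\<^sub>F nhds 0)"
    by (intro tendsto_intros filterlim_fst filterlim_snd)
  then have "\<forall>\<^sub>F p in nhds (0::'a) \<times>\<^sub>F nhds 0. s + fst p - snd p \<in> X"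
    using X by (auto dest: topological_tendstoD)
  then obtain W where W: "\<forall>\<^sub>F u in nhds (0::'a). W u" "\<And>u v. W u \<Longrightarrow> W v \<Longrightarrow> s + u - v \<in> X"
    unfolding eventually_prod_same by auto
  have near: "\<forall>\<^sub>F F in finite_subsets_at_top C. W (sum f F - t)" if "(f has_sum t) C" for C t
  proof -
    have "((\<lambda>F. sum f F - t) \<longlongrightarrow> t - t) (finite_subsets_at_top C)"
      using that unfolding has_sum_def by (intro tendsto_intros)
    then show ?thesis
      using W(1) by (simp add: filterlim_iff)
  qed
  obtain Y where Y: "finite Y" "Y \<subseteq> Sigma A B"
    "\<forall>F. finite F \<and> Y \<subseteq> F \<and> F \<subseteq> Sigma A B \<longrightarrow> W (sum f F - s)"
    using near[OF sumf] unfolding eventually_finite_subsets_at_top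
    by (elim exE conjE) (rule that)
  show "\<forall>\<^sub>F Z in finite_subsets_at_top A. sum g Z \<in> X"
    unfolding eventually_finite_subsets_at_top
  \<comment> \<open>The witness consists of the outer indices occurring in \<open>Y\<close>: if
    \<open>Z\<close> contains them, then \<open>Y\<close> lies in \<open>Sigma Z B\<close>, so
    \<open>G \<union> Y\<close> is large enough both for \<open>s\<close> and for
    \<open>sum g Z\<close>.\<close>
  proof (intro exI[of _ "fst ` Y"] conjI allI impI)
    fix Z assume Z: "finite Z \<and> fst ` Y \<subseteq> Z \<and> Z \<subseteq> A"
    then have "(f has_sum sum g Z) (Sigma Z B)"
      using inner by (intro has_sum_Sigma_finite) auto
    from near[OF this] obtain G where G: "finite G" "G \<subseteq> Sigma Z B"
      "\<forall>F. finite F \<and> G \<subseteq> F \<and> F \<subseteq> Sigma Z B \<longrightarrow> W (sum f F - sum g Z)"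
      unfolding eventually_finite_subsets_at_top by (elim exE conjE) (rule that)
    have "Y \<subseteq> Sigma Z B"
      using Y(2) Z by force
    moreover have "Sigma Z B \<subseteq> Sigma A B"
      using Z by auto
    ultimately have "W (sum f (G \<union> Y) - s)" "W (sum f (G \<union> Y) - sum g Z)"
      using G Y by simp_all
    \<comment> \<open>With the two differences as \<open>u\<close> and \<open>v\<close>, the
      expression \<open>s + u - v\<close> collapses to \<open>sum g Z\<close>.\<close>
    then show "sum g Z \<in> X"
      using W(2)[of "sum f (G \<union> Y) - s" "sum f (G \<union> Y) - sum g Z"] by (simp add: algebra_simps)
  qed (use Y in auto)
qed

subsection \<open>Rings of sets\<close>

lemma ring_UnD: "ring_of_sets UNIV Q \<Longrightarrow> A \<in> Q \<Longrightarrow> B \<in> Q \<Longrightarrow> A \<union> B \<in> Q"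
  and ring_DiffD: "ring_of_sets UNIV Q \<Longrightarrow> A \<in> Q \<Longrightarrow> B \<in> Q \<Longrightarrow> A - B \<in> Q"
  and ring_emptyD: "ring_of_sets UNIV Q \<Longrightarrow> {} \<in> Q"
  by (auto simp: ring_of_sets_iff)

lemma ring_IntD: "ring_of_sets UNIV Q \<Longrightarrow> A \<in> Q \<Longrightarrow> B \<in> Q \<Longrightarrow> A \<inter> B \<in> Q"
  by (metis Diff_Diff_Int ring_DiffD)

lemma delta_ring_imp_ring: "delta_ring Q \<Longrightarrow> ring_of_sets UNIV Q"
  by (simp add: delta_ring_def)

lemma delta_ring_INT:
  assumes "delta_ring D" "countable I" "I \<noteq> {}" "\<And>i. i \<in> I \<Longrightarrow> A i \<in> D"
  shows "(\<Inter>i\<in>I. A i) \<in> D"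
proof -
  have "A ` I \<noteq> {} \<and> countable (A ` I) \<and> A ` I \<subseteq> D"
    using assms(2-4) by auto
  then show ?thesis
    using assms(1)[unfolded delta_ring_def, THEN conjunct2, rule_format] by simp
qed

lemma sigma_ring_imp_ring: "sigma_ring Q \<Longrightarrow> ring_of_sets UNIV Q"
  by (simp add: sigma_ring_def)

lemma sigma_ring_UN:
  assumes "sigma_ring Q" "countable I" "\<And>i. i \<in> I \<Longrightarrow> A i \<in> Q"
  shows "(\<Union>i\<in>I. A i) \<in> Q"
  using assms unfolding sigma_ring_def by (simp add: image_subset_iff)

lemma sigma_ring_imp_delta_ring:
  assumes "sigma_ring Q"
  shows "delta_ring Q"
  unfolding delta_ring_def
proof (intro conjI allI impI)
  fix F assume F: "F \<noteq> {} \<and> countable F \<and> F \<subseteq> Q"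
  then obtain A where "A \<in> F"
    by auto
  then have "\<Inter>F = A - (\<Union>B\<in>F. A - B)"
    by auto
  moreover have "(\<Union>B\<in>F. A - B) \<in> Q"
    using assms F \<open>A \<in> F\<close> by (intro sigma_ring_UN) (auto intro: ring_DiffD sigma_ring_imp_ring)
  ultimately show "\<Inter>F \<in> Q"
    using F \<open>A \<in> F\<close> ring_DiffD[OF sigma_ring_imp_ring[OF assms]] by (metis subsetD)
qed (use assms in \<open>rule sigma_ring_imp_ring\<close>)

section \<open>The \<sigma>-ring generated by a \<delta>-ring\<close>

lemma sigma_ring_hull: "sigma_ring (sigma_ring hull D)"
proof (rule hull_in)
  fix T :: "'x set set set" assume T: "Ball T sigma_ring"
  then have "ring_of_sets UNIV Q" if "Q \<in> T" for Q
    using that by (auto intro: sigma_ring_imp_ring)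
  then have "ring_of_sets UNIV (\<Inter>T)"
    by (auto simp: ring_of_sets_iff)
  then show "sigma_ring (\<Inter>T)"
    using T unfolding sigma_ring_def by blast
qed

lemma delta_ring_Int:
  assumes "delta_ring D" "delta_ring E"
  shows "delta_ring (D \<inter> E)"
proof -
  have "ring_of_sets UNIV (D \<inter> E)"
    using assms by (auto simp: delta_ring_def ring_of_sets_iff)
  then show ?thesis
    using assms by (simp add: delta_ring_def)
qed

text \<open>The sets with both properties form a \<sigma>-ring containing \<open>D\<close>, so the
  generated \<sigma>-ring lies among them. The first property makes \<open>D\<close> an ideal; from
  the cover, partitions into sets of \<open>D\<close> are built.\<close>

lemma hull_delta_ring_Int_and_cover:
  assumes D: "delta_ring D" and A: "A \<in> sigma_ring hull D"
  shows "(\<forall>B\<in>D. A \<inter> B \<in> D) \<and> (\<exists>F. countable F \<and> F \<subseteq> D \<and> A \<subseteq> \<Union>F)"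
proof -
  note ring = delta_ring_imp_ring[OF D]
  let ?S = "{A. (\<forall>B\<in>D. A \<inter> B \<in> D) \<and> (\<exists>F. countable F \<and> F \<subseteq> D \<and> A \<subseteq> \<Union>F)}"
  have UN: "\<Union>K \<in> ?S" if K: "countable K" "K \<subseteq> ?S" for K
  proof -
    have "\<Union>K \<inter> B \<in> D" if "B \<in> D" for B
    proof (cases "K = {}")
      case True
      then show ?thesis using ring by (simp add: ring_emptyD)
    next
      case False
      \<comment> \<open>De Morgan inside \<open>B\<close> turns the countable union into a countable
        intersection, under which \<open>D\<close> is closed provided the family is nonempty; hence
        the case distinction.\<close>
      have "(\<Inter>A\<in>K. B - A \<inter> B) \<in> D"
      proof (rule delta_ring_INT[OF D K(1) False])
        fix A assume "A \<in> K"
        then show "B - A \<inter> B \<in> D"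
          using K(2) \<open>B \<in> D\<close> by (intro ring_DiffD[OF ring]) auto
      qed
      then have "B - (\<Inter>A\<in>K. B - A \<inter> B) \<in> D"
        using \<open>B \<in> D\<close> by (intro ring_DiffD[OF ring])
      also have "B - (\<Inter>A\<in>K. B - A \<inter> B) = \<Union>K \<inter> B"
        using False by auto
      finally show ?thesis .
    qed
    moreover obtain F where F: "\<And>A. A \<in> K \<Longrightarrow> countable (F A) \<and> F A \<subseteq> D \<and> A \<subseteq> \<Union>(F A)"
      using K(2) by (simp add: subset_iff) metis
    then have "countable (\<Union>(F ` K)) \<and> \<Union>(F ` K) \<subseteq> D \<and> \<Union>K \<subseteq> \<Union>(\<Union>(F ` K))"
      using K(1) by (fastforce simp: subset_iff)
    ultimately show ?thesis
      by blast
  qed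
  have "sigma_ring ?S"
    unfolding sigma_ring_def ring_of_sets_UNIV_iff
  proof (intro conjI ballI allI impI)
    have "{} \<in> ?S"
      using ring by (auto simp: ring_emptyD)
    then show "?S \<noteq> {}"
      by blast
    fix A B assume A: "A \<in> ?S" and B: "B \<in> ?S"
    show "A \<union> B \<in> ?S"
      using UN[of "{A, B}"] A B by simp
    have "(A - B) \<inter> C \<in> D" if "C \<in> D" for C
    proof -
      have "A \<inter> C - B \<inter> C \<in> D"
        using A B that ring by (auto intro: ring_DiffD)
      then show ?thesis
        by (simp add: Int_Diff Diff_Int_distrib2)
    qed
    moreover obtain F where "countable F" "F \<subseteq> D" "A \<subseteq> \<Union>F"
      using A by blast
    moreover from this have "A - B \<subseteq> \<Union>F"
      by blast
    ultimately show "A - B \<in> ?S"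
      by (intro CollectI conjI ballI exI[of _ F])
  next
    fix K assume "countable K \<and> K \<subseteq> ?S"
    then show "\<Union>K \<in> ?S"
      by (intro UN) simp_all
  qed
  moreover have "D \<subseteq> ?S"
  proof
    fix A assume "A \<in> D"
    then show "A \<in> ?S"
      by (intro CollectI conjI ballI ring_IntD[OF ring] exI[of _ "{A}"]) simp_all
  qed
  ultimately have "sigma_ring hull D \<subseteq> ?S"
    by (intro hull_minimal)
  then show ?thesis
    using A by blast
qed

lemma delta_ring_ideal:
  assumes "delta_ring D" "A \<in> sigma_ring hull D" "B \<in> D" "A \<subseteq> B"
  shows "A \<in> D"
  using hull_delta_ring_Int_and_cover[OF assms(1,2)] assms(3,4) by (metis Int_absorb2)

text \<open>The intersections of \<open>A\<close> with a countable cover from \<open>D\<close> lie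
  in \<open>D\<close>, and making them disjoint stays inside the ring.\<close>

lemma hull_partition:
  assumes D: "delta_ring D" and A: "A \<in> sigma_ring hull D"
  obtains P where "partition_into D A (UNIV::nat set) P"
proof -
  note ring = delta_ring_imp_ring[OF D]
  obtain F where F: "countable F" "F \<subseteq> D" "A \<subseteq> \<Union>F" and Int: "\<And>B. B \<in> D \<Longrightarrow> A \<inter> B \<in> D"
    using hull_delta_ring_Int_and_cover[OF D A] by blast
  \<comment> \<open>Inserting the empty set makes the cover nonempty, so that
    \<open>from_nat_into\<close> enumerates exactly its members.\<close>
  define R where "R n = A \<inter> from_nat_into (insert {} F) n" for n
  have range: "range (from_nat_into (insert {} F)) = insert {} F"
    using F(1) by (intro range_from_nat_into) auto
  have "from_nat_into (insert {} F) n \<in> D" for n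
    using range F(2) ring_emptyD[OF ring] by (metis insert_subset rangeI subsetD)
  then have "range R \<subseteq> D"
    unfolding R_def by (auto intro: Int)
  then have "range (disjointed R) \<subseteq> D"
    by (rule ring_of_sets.range_disjointed_sets[OF ring])
  moreover have "(\<Union>n. R n) = A \<inter> \<Union>(range (from_nat_into (insert {} F)))"
    unfolding R_def by blast
  then have "(\<Union>n. R n) = A"
    using F(3) unfolding range by auto
  ultimately have "partition_into D A UNIV (disjointed R)"
    by (simp add: partition_into_def disjoint_family_disjointed UN_disjointed_eq)
  then show thesis ..
qed

text \<open>A set of \<open>D\<close> is a countable disjoint union of sets of \<open>E\<close>.
  These are subsets of a set of \<open>D\<close> within the common generated \<sigma>-ring, so the
  ideal property puts them in \<open>D\<close> too. This gives the pointwise sum of two premeasures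
  the right host.\<close>

lemma hull_Int_delta_rings:
  assumes D: "delta_ring D" and E: "delta_ring E" and eq: "sigma_ring hull D = sigma_ring hull E"
  shows "sigma_ring hull (D \<inter> E) = sigma_ring hull D"
proof
  show "sigma_ring hull (D \<inter> E) \<subseteq> sigma_ring hull D"
    by (rule hull_mono) simp
  have "D \<subseteq> sigma_ring hull (D \<inter> E)"
  proof
    fix A assume A: "A \<in> D"
    then have "A \<in> sigma_ring hull E"
      using eq hull_inc by metis
    then obtain P where P: "partition_into E A (UNIV::nat set) P"
      using hull_partition[OF E] by blast
    have "P n \<in> D \<inter> E" for n
    proof -
      have "P n \<in> E" "P n \<subseteq> A"
        using P by (auto simp: partition_into_def)
      moreover from this have "P n \<in> D"
        using delta_ring_ideal[OF D _ A] eq hull_inc by metis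
      ultimately show ?thesis
        by simp
    qed
    then have "(\<Union>n. P n) \<in> sigma_ring hull (D \<inter> E)"
      by (intro sigma_ring_UN sigma_ring_hull) (auto intro: hull_inc)
    then show "A \<in> sigma_ring hull (D \<inter> E)"
      using P by (simp add: partition_into_def)
  qed
  then show "sigma_ring hull D \<subseteq> sigma_ring hull (D \<inter> E)"
    by (intro hull_minimal sigma_ring_hull)
qed

subsection \<open>The maximal extension of a premeasure\<close>

lemma partition_into_mono: "partition_into D A I P \<Longrightarrow> D \<subseteq> E \<Longrightarrow> partition_into E A I P"
  by (auto simp: partition_into_def)

lemma partition_into_Int:
  assumes "partition_into D A I P" "\<And>i. i \<in> I \<Longrightarrow> P i \<inter> B \<in> E"
  shows "partition_into E (A \<inter> B) I (\<lambda>i. P i \<inter> B)"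
proof -
  have "disjoint_family_on (\<lambda>i. P i \<inter> B) I" "(\<Union>i\<in>I. P i \<inter> B) = A \<inter> B"
    using assms(1) by (auto simp: partition_into_def disjoint_family_on_def)
  then show ?thesis
    using assms(2) by (auto simp: partition_into_def)
qed

text \<open>Refines a partition cell by cell; the pairs as indices prepare for iterated
  summation.\<close>

lemma partition_into_Sigma:
  assumes "partition_into E A I R" "\<And>i. i \<in> I \<Longrightarrow> partition_into D (R i) (J i) (P i)"
  shows "partition_into D A (Sigma I J) (\<lambda>(i, j). P i j)"
proof -
  have sub: "P i j \<subseteq> R i" if "i \<in> I" "j \<in> J i" for i j
    using that assms(2) by (auto simp: partition_into_def)
  have "P i j \<inter> P i' j' = {}" if "i \<in> I" "j \<in> J i" "i' \<in> I" "j' \<in> J i'" "(i, j) \<noteq> (i', j')" for i j i' j'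
  proof (cases "i = i'")
    case True
    then show ?thesis
      using that assms(2)[of i] by (auto simp: partition_into_def disjoint_family_on_def)
  next
    case False
    then have "R i \<inter> R i' = {}"
      using that assms(1) by (auto simp: partition_into_def disjoint_family_on_def)
    then show ?thesis
      using sub that by blast
  qed
  then have "disjoint_family_on (\<lambda>(i, j). P i j) (Sigma I J)"
    unfolding disjoint_family_on_def by auto
  moreover have "(\<Union>(i, j)\<in>Sigma I J. P i j) = (\<Union>i\<in>I. \<Union>j\<in>J i. P i j)"
    by auto
  then have "(\<Union>(i, j)\<in>Sigma I J. P i j) = (\<Union>i\<in>I. R i)"
    using assms(2) by (simp add: partition_into_def)
  moreover have "(\<lambda>(i, j). P i j) ` Sigma I J \<subseteq> D"
    using assms(2) by (fastforce simp: partition_into_def)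
  ultimately show ?thesis
    using assms(1) by (simp add: partition_into_def)
qed

text \<open>\<open>A\<close> may lie outside \<open>dom \<mu>\<close>. The notion is meant for
  \<open>A\<close> in the host, where partitions exist; on a set without partitions into
  \<open>dom \<mu>\<close> it holds vacuously for every \<open>s\<close>.\<close>

definition partition_sum :: "('x set \<rightharpoonup> 'a::topological_comm_monoid_add) \<Rightarrow> 'x set \<Rightarrow> 'a \<Rightarrow> bool" where
  "partition_sum \<mu> A s \<longleftrightarrow>
     (\<forall>(I::nat set) P. partition_into (dom \<mu>) A I P \<longrightarrow> ((\<lambda>i. the (\<mu> (P i))) has_sum s) I)"

text \<open>Quantifying over all subsets in the host makes the property hereditary, which later
  gives closure under differences and countable intersections.\<close>

definition extendable :: "('x set \<rightharpoonup> 'a::topological_comm_monoid_add) \<Rightarrow> 'x set \<Rightarrow> bool" where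
  "extendable \<mu> A \<longleftrightarrow> A \<in> host \<mu> \<and> (\<forall>B\<in>host \<mu>. B \<subseteq> A \<longrightarrow> (\<exists>s. partition_sum \<mu> B s))"

definition maximal_extension :: "('x set \<rightharpoonup> 'a::topological_comm_monoid_add) \<Rightarrow> ('x set \<rightharpoonup> 'a)" where
  "maximal_extension \<mu> = (\<lambda>A. if extendable \<mu> A then Some (THE s. partition_sum \<mu> A s) else None)"

lemma premeasure_delta_ring: "premeasure \<mu> \<Longrightarrow> delta_ring (dom \<mu>)"
  by (simp add: premeasure_def)

text \<open>Enumeration of the index set; needed for refinements, which are indexed by
  pairs.\<close>

lemma partition_sum_countable:
  assumes "partition_sum \<mu> A s" "countable I" "partition_into (dom \<mu>) A I P"
  shows "((\<lambda>i. the (\<mu> (P i))) has_sum s) I"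
proof -
  let ?J = "to_nat_on I ` I"
  have bij: "bij_betw (from_nat_into I) ?J I"
    using assms(2) by (auto simp: bij_betw_def inj_on_def image_image)
  have "partition_into (dom \<mu>) A ?J (P \<circ> from_nat_into I)"
    using assms(2,3) by (auto simp: partition_into_def disjoint_family_on_def)
  then have "((\<lambda>i. the (\<mu> ((P \<circ> from_nat_into I) i))) has_sum s) ?J"
    using assms(1) unfolding partition_sum_def by blast
  then show ?thesis
    using has_sum_reindex_bij_betw[OF bij, of "\<lambda>i. the (\<mu> (P i))"] by simp
qed

text \<open>A partition exists because \<open>A\<close> lies in the host, and sums along it are
  unique in a Hausdorff space. This justifies the \<open>THE\<close> in
  \<open>maximal_extension\<close>.\<close>

lemma partition_sum_unique:
  fixes \<mu> :: "'x set \<rightharpoonup> 'a::{topological_comm_monoid_add, t2_space}"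
  assumes "delta_ring (dom \<mu>)" "A \<in> host \<mu>" "partition_sum \<mu> A s" "partition_sum \<mu> A t"
  shows "s = t"
proof -
  obtain P where "partition_into (dom \<mu>) A (UNIV::nat set) P"
    using hull_partition[OF assms(1) assms(2)[unfolded host_def]] .
  then show ?thesis
    using assms(3,4) unfolding partition_sum_def
    by (intro has_sum_unique[of "\<lambda>i. the (\<mu> (P i))" UNIV s t]) simp_all
qed

lemma host_sigma_ring: "sigma_ring (host \<mu>)"
  unfolding host_def by (rule sigma_ring_hull)

lemma dom_subset_host: "dom \<mu> \<subseteq> host \<mu>"
  unfolding host_def by (rule hull_subset)

lemma premeasure_ideal:
  "premeasure \<mu> \<Longrightarrow> A \<in> host \<mu> \<Longrightarrow> B \<in> dom \<mu> \<Longrightarrow> A \<subseteq> B \<Longrightarrow> A \<in> dom \<mu>"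
  unfolding host_def by (rule delta_ring_ideal[OF premeasure_delta_ring])

lemma dom_maximal_extension: "dom (maximal_extension \<mu>) = {A. extendable \<mu> A}"
  by (auto simp: maximal_extension_def dom_def)

lemma extendable_subset: "extendable \<mu> A \<Longrightarrow> B \<in> host \<mu> \<Longrightarrow> B \<subseteq> A \<Longrightarrow> extendable \<mu> B"
  unfolding extendable_def by (meson order_trans)

lemma maximal_extension_eqI:
  fixes \<mu> :: "'x set \<rightharpoonup> 'a::{topological_comm_monoid_add, t2_space}"
  assumes "delta_ring (dom \<mu>)" "extendable \<mu> A" "partition_sum \<mu> A s"
  shows "maximal_extension \<mu> A = Some s"
proof -
  have "(THE s. partition_sum \<mu> A s) = s"
    using assms partition_sum_unique by (intro the_equality) (auto simp: extendable_def)
  then show ?thesis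
    using assms by (simp add: maximal_extension_def)
qed

lemma maximal_extension_partition_sum:
  fixes \<mu> :: "'x set \<rightharpoonup> 'a::{topological_comm_monoid_add, t2_space}"
  assumes "delta_ring (dom \<mu>)" "extendable \<mu> A"
  shows "partition_sum \<mu> A (the (maximal_extension \<mu> A))"
proof -
  obtain s where "partition_sum \<mu> A s"
    using assms(2) unfolding extendable_def by blast
  then show ?thesis
    using maximal_extension_eqI[OF assms] by simp
qed

lemma similar_eqD: "similar \<mu> \<nu> \<Longrightarrow> A \<in> dom \<mu> \<Longrightarrow> A \<in> dom \<nu> \<Longrightarrow> \<mu> A = \<nu> A"
  by (simp add: similar_def)

text \<open>Cells from \<open>dom \<mu>\<close> of a set in \<open>dom \<nu>\<close> belong to
  \<open>dom \<nu>\<close> by the ideal property. There both maps agree, so countable additivity of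
  \<open>\<nu>\<close> computes the \<open>\<mu>\<close>-sum as the value of \<open>\<nu>\<close>.
  The case \<open>\<nu> = \<mu>\<close> shows that \<open>\<mu>\<close> itself is extended.\<close>

lemma similar_subset_maximal_extension:
  fixes \<mu> :: "'x set \<rightharpoonup> 'a::{topological_comm_monoid_add, t2_space}"
  assumes \<mu>: "premeasure \<mu>" and \<nu>: "premeasure \<nu>" and sim: "similar \<nu> \<mu>"
  shows "\<nu> \<subseteq>\<^sub>m maximal_extension \<mu>"
  unfolding map_le_def
proof
  fix A assume A: "A \<in> dom \<nu>"
  have host: "host \<nu> = host \<mu>"
    using sim by (simp add: similar_def)
  have sum: "partition_sum \<mu> B (the (\<nu> B))" if B: "B \<in> dom \<nu>" for B
    unfolding partition_sum_def
  proof (intro allI impI)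
    fix I :: "nat set" and P assume P: "partition_into (dom \<mu>) B I P"
    have Pd: "P i \<in> dom \<mu> \<inter> dom \<nu>" if "i \<in> I" for i
    proof -
      have "P i \<in> dom \<mu>" "P i \<subseteq> B"
        using P that by (auto simp: partition_into_def)
      then show ?thesis
        using premeasure_ideal[OF \<nu> _ B] dom_subset_host[of \<mu>] host by blast
    qed
    then have "partition_into (dom \<nu>) B I P"
      using P by (auto simp: partition_into_def)
    then have "((\<lambda>i. the (\<nu> (P i))) has_sum the (\<nu> B)) I"
      by (rule premeasure_has_sum[OF \<nu> B countableI_type])
    moreover have "\<nu> (P i) = \<mu> (P i)" if "i \<in> I" for i
      using Pd[OF that] by (intro similar_eqD[OF sim]) simp_all
    ultimately show "((\<lambda>i. the (\<mu> (P i))) has_sum the (\<nu> B)) I"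
      by (simp cong: has_sum_cong)
  qed
  have "extendable \<mu> A"
    unfolding extendable_def
  proof (intro conjI ballI impI)
    show "A \<in> host \<mu>"
      using A host dom_subset_host[of \<nu>] by auto
    fix B assume "B \<in> host \<mu>" "B \<subseteq> A"
    then have "B \<in> dom \<nu>"
      using host by (intro premeasure_ideal[OF \<nu> _ A]) simp_all
    then show "\<exists>s. partition_sum \<mu> B s"
      using sum by (intro exI)
  qed
  then have "maximal_extension \<mu> A = Some (the (\<nu> A))"
    using sum[OF A] by (rule maximal_extension_eqI[OF premeasure_delta_ring[OF \<mu>]])
  then show "\<nu> A = maximal_extension \<mu> A"
    using A by (simp add: domIff)
qed

lemma similar_refl: "similar \<mu> \<mu>"
  by (simp add: similar_def)

lemma similar_sym: "similar \<mu> \<nu> \<Longrightarrow> similar \<nu> \<mu>"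
  by (auto simp: similar_def)

lemma map_le_similar: "\<mu> \<subseteq>\<^sub>m \<nu> \<Longrightarrow> host \<mu> = host \<nu> \<Longrightarrow> similar \<mu> \<nu>"
  by (auto simp: similar_def map_le_def)

lemma host_maximal_extension:
  fixes \<mu> :: "'x set \<rightharpoonup> 'a::{topological_comm_monoid_add, t2_space}"
  assumes "premeasure \<mu>"
  shows "host (maximal_extension \<mu>) = host \<mu>"
proof
  have "\<mu> \<subseteq>\<^sub>m maximal_extension \<mu>"
    using assms assms similar_refl by (rule similar_subset_maximal_extension)
  then show "host \<mu> \<subseteq> host (maximal_extension \<mu>)"
    unfolding host_def by (intro hull_mono map_le_implies_dom_le)
  show "host (maximal_extension \<mu>) \<subseteq> host \<mu>"
    unfolding host_def[of "maximal_extension \<mu>"]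
    by (intro hull_minimal host_sigma_ring) (auto simp: dom_maximal_extension extendable_def)
qed

text \<open>A set \<open>C\<close> below \<open>A \<union> B\<close> splits into a part below
  \<open>A\<close> and a part below \<open>B\<close>. Every cell of a partition of \<open>C\<close>
  splits likewise, so the two partition sums add up.\<close>

lemma extendable_Un:
  fixes \<mu> :: "'x set \<rightharpoonup> 'a::{topological_comm_monoid_add, t2_space}"
  assumes \<mu>: "premeasure \<mu>" and A: "extendable \<mu> A" and B: "extendable \<mu> B"
  shows "extendable \<mu> (A \<union> B)"
  unfolding extendable_def
proof (intro conjI ballI impI)
  note ring = sigma_ring_imp_ring[OF host_sigma_ring[of \<mu>]]
  have AB: "A \<in> host \<mu>" "B \<in> host \<mu>"
    using A B by (auto simp: extendable_def)
  then show "A \<union> B \<in> host \<mu>"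
    by (rule ring_UnD[OF ring])
  fix C assume C: "C \<in> host \<mu>" "C \<subseteq> A \<union> B"
  \<comment> \<open>The difference is written as an intersection with \<open>- A\<close>, so that
    \<open>partition_into_Int\<close> covers both parts.\<close>
  have Int: "C \<inter> A \<in> host \<mu>" and Diff: "C \<inter> - A \<in> host \<mu>"
    using C AB ring by (auto intro: ring_IntD ring_DiffD simp flip: Diff_eq)
  obtain s t where s: "partition_sum \<mu> (C \<inter> A) s" and t: "partition_sum \<mu> (C \<inter> - A) t"
    using A B Int Diff C(2) unfolding extendable_def by (metis Int_lower2 Diff_eq Diff_subset_conv)
  have "partition_sum \<mu> C (s + t)"
    unfolding partition_sum_def
  proof (intro allI impI)
    fix I :: "nat set" and P assume P: "partition_into (dom \<mu>) C I P"
    have dom: "P i \<inter> A \<in> dom \<mu>" "P i \<inter> - A \<in> dom \<mu>" if "i \<in> I" for i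
    proof -
      have Pi: "P i \<in> dom \<mu>"
        using P that by (auto simp: partition_into_def)
      then have "P i \<inter> A \<in> host \<mu>" "P i \<inter> - A \<in> host \<mu>"
        using dom_subset_host[of \<mu>] AB ring by (auto intro: ring_IntD ring_DiffD simp flip: Diff_eq)
      then show "P i \<inter> A \<in> dom \<mu>" "P i \<inter> - A \<in> dom \<mu>"
        using premeasure_ideal[OF \<mu> _ Pi] by blast+
    qed
    have "((\<lambda>i. the (\<mu> (P i \<inter> A)) + the (\<mu> (P i \<inter> - A))) has_sum (s + t)) I"
      using s t partition_into_Int[OF P dom(1)] partition_into_Int[OF P dom(2)]
      unfolding partition_sum_def by (intro has_sum_add) auto
    moreover have "the (\<mu> (P i \<inter> A)) + the (\<mu> (P i \<inter> - A)) = the (\<mu> (P i))" if "i \<in> I" for i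
    proof -
      \<comment> \<open>Finite additivity on one cell, obtained from countable additivity with a
        two-element index set.\<close>
      have "partition_into (dom \<mu>) (P i) {True, False} (\<lambda>b. if b then P i \<inter> A else P i \<inter> - A)"
        using dom[OF that] by (auto simp: partition_into_def disjoint_family_on_def)
      moreover have "P i \<in> dom \<mu>"
        using P that by (auto simp: partition_into_def)
      ultimately have "((\<lambda>b. the (\<mu> (if b then P i \<inter> A else P i \<inter> - A))) has_sum the (\<mu> (P i))) {True, False}"
        by (intro premeasure_has_sum[OF \<mu>]) auto
      then show ?thesis
        by (simp add: has_sum_finite_iff)
    qed
    ultimately show "((\<lambda>i. the (\<mu> (P i))) has_sum (s + t)) I"
      by (simp cong: has_sum_cong)
  qed
  then show "\<exists>s. partition_sum \<mu> C s"
    by blast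
qed

text \<open>Differences and countable intersections are subsets, in the host, of extendable sets, so
  heredity settles them; unions are the content of \<open>extendable_Un\<close>.\<close>

lemma delta_ring_maximal_extension:
  fixes \<mu> :: "'x set \<rightharpoonup> 'a::{topological_comm_monoid_add, t2_space}"
  assumes \<mu>: "premeasure \<mu>"
  shows "delta_ring (dom (maximal_extension \<mu>))"
  unfolding delta_ring_def ring_of_sets_UNIV_iff dom_maximal_extension
proof (intro conjI ballI allI impI)
  note host = host_sigma_ring[of \<mu>]
  have "dom \<mu> \<subseteq> {A. extendable \<mu> A}"
    using map_le_implies_dom_le[OF similar_subset_maximal_extension[OF \<mu> \<mu> similar_refl]]
    by (simp add: dom_maximal_extension)
  then show "{A. extendable \<mu> A} \<noteq> {}"
    using ring_emptyD[OF delta_ring_imp_ring[OF premeasure_delta_ring[OF \<mu>]]] by blast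
  fix A B assume "A \<in> {A. extendable \<mu> A}" "B \<in> {A. extendable \<mu> A}"
  then have AB: "extendable \<mu> A" "extendable \<mu> B"
    by auto
  show "A \<union> B \<in> {A. extendable \<mu> A}"
    using extendable_Un[OF \<mu> AB] by simp
  have "A - B \<in> host \<mu>"
    using AB by (auto simp: extendable_def intro: ring_DiffD[OF sigma_ring_imp_ring[OF host]])
  then show "A - B \<in> {A. extendable \<mu> A}"
    using extendable_subset[OF AB(1)] by blast
next
  fix F assume F: "F \<noteq> {} \<and> countable F \<and> F \<subseteq> {A. extendable \<mu> A}"
  then obtain A where A: "A \<in> F" "extendable \<mu> A"
    by blast
  have "F \<subseteq> host \<mu>"
    using F by (auto simp: extendable_def)
  then have "\<Inter>F \<in> host \<mu>"
    using F sigma_ring_imp_delta_ring[OF host_sigma_ring[of \<mu>]] unfolding delta_ring_def by blast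
  then show "\<Inter>F \<in> {A. extendable \<mu> A}"
    using extendable_subset[OF A(2)] A(1) by blast
qed

text \<open>Partition each \<open>R i\<close> into sets of \<open>dom \<mu>\<close>. All these cells
  together partition \<open>A\<close>, so their \<open>\<mu>\<close>-sum is the value at
  \<open>A\<close>, while each inner sum is the value at \<open>R i\<close>. The group structure
  enters through the iterated sum.\<close>

lemma premeasure_maximal_extension:
  fixes \<mu> :: "'x set \<rightharpoonup> 'a::{topological_ab_group_add, t2_space}"
  assumes \<mu>: "premeasure \<mu>"
  shows "premeasure (maximal_extension \<mu>)"
  unfolding premeasure_def
proof (intro conjI ballI allI impI)
  let ?\<rho> = "maximal_extension \<mu>"
  note D = premeasure_delta_ring[OF \<mu>]
  show "delta_ring (dom ?\<rho>)"
    using \<mu> by (rule delta_ring_maximal_extension)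
  fix A and I :: "nat set" and R
  assume A: "A \<in> dom ?\<rho>" and R: "partition_into (dom ?\<rho>) A I R"
  have ext: "extendable \<mu> (R i)" if "i \<in> I" for i
    using R that by (auto simp: partition_into_def dom_maximal_extension)
  then have "\<forall>i\<in>I. \<exists>P. partition_into (dom \<mu>) (R i) (UNIV::nat set) P"
    using hull_partition[OF D] unfolding extendable_def host_def by metis
  then obtain P where P: "\<And>i. i \<in> I \<Longrightarrow> partition_into (dom \<mu>) (R i) (UNIV::nat set) (P i)"
    by metis
  have "((\<lambda>p. the (\<mu> (case p of (i, j) \<Rightarrow> P i j))) has_sum the (?\<rho> A)) (I \<times> UNIV)"
    using A by (intro partition_sum_countable[OF maximal_extension_partition_sum[OF D]]
        partition_into_Sigma[OF R P]) (auto simp: dom_maximal_extension)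
  then show "((\<lambda>i. the (?\<rho> (R i))) has_sum the (?\<rho> A)) I"
  proof (rule has_sum_Sigma_topological_group)
    fix i assume "i \<in> I"
    then show "((\<lambda>j. the (\<mu> (case (i, j) of (i, j) \<Rightarrow> P i j))) has_sum the (?\<rho> (R i))) UNIV"
      using P maximal_extension_partition_sum[OF D ext] by (simp add: partition_sum_def)
  qed
qed

lemma similar_maximal_extension:
  fixes \<mu> :: "'x set \<rightharpoonup> 'a::{topological_comm_monoid_add, t2_space}"
  assumes "premeasure \<mu>"
  shows "similar (maximal_extension \<mu>) \<mu>"
  using similar_subset_maximal_extension[OF assms assms similar_refl] host_maximal_extension[OF assms]
  by (intro similar_sym[OF map_le_similar]) simp_all

subsection \<open>The associated measure\<close>

text \<open>The domains of \<open>\<mu>\<close> and \<open>\<rho>\<close> may meet outside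
  \<open>dom \<nu>\<close>, so agreement there is not immediate. It holds because both maps are
  restrictions of \<open>maximal_extension \<nu>\<close>.\<close>

lemma similar_trans:
  fixes \<mu> :: "'x set \<rightharpoonup> 'a::{topological_comm_monoid_add, t2_space}"
  assumes \<mu>: "premeasure \<mu>" and \<nu>: "premeasure \<nu>" and \<rho>: "premeasure \<rho>"
    and "similar \<mu> \<nu>" "similar \<nu> \<rho>"
  shows "similar \<mu> \<rho>"
proof -
  have "\<mu> \<subseteq>\<^sub>m maximal_extension \<nu>" "\<rho> \<subseteq>\<^sub>m maximal_extension \<nu>"
    using assms by (auto intro: similar_subset_maximal_extension similar_sym)
  then show ?thesis
    using assms(4,5) unfolding similar_def map_le_def by simp
qed

text \<open>By transitivity, a premeasure similar to the extension is similar to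
  \<open>\<mu>\<close>, hence a restriction of the extension.\<close>

lemma ring_measure_maximal_extension:
  fixes \<mu> :: "'x set \<rightharpoonup> 'a::{topological_ab_group_add, t2_space}"
  assumes \<mu>: "premeasure \<mu>"
  shows "ring_measure (maximal_extension \<mu>)"
  unfolding ring_measure_def
proof (intro conjI allI impI)
  show \<rho>: "premeasure (maximal_extension \<mu>)"
    using \<mu> by (rule premeasure_maximal_extension)
  fix \<nu> assume \<nu>: "premeasure \<nu> \<and> similar \<nu> (maximal_extension \<mu>)"
  then have "similar \<nu> \<mu>"
    using similar_trans[OF _ \<rho> \<mu> _ similar_maximal_extension[OF \<mu>]] by simp
  then show "\<nu> \<subseteq>\<^sub>m maximal_extension \<mu>"
    using \<nu> by (intro similar_subset_maximal_extension[OF \<mu>]) simp_all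
qed

lemma ring_measure_unique:
  assumes "ring_measure \<mu>" "ring_measure \<nu>" "similar \<mu> \<nu>"
  shows "\<mu> = \<nu>"
  using assms similar_sym[OF assms(3)] by (intro map_le_antisym) (simp_all add: ring_measure_def)

text \<open>Two measures similar to \<open>\<mu>\<close> are similar to each other by transitivity
  through \<open>\<mu>\<close>, hence each extends the other.\<close>

lemma associated_measure_eqI:
  fixes \<mu> :: "'x set \<rightharpoonup> 'a::{topological_comm_monoid_add, t2_space}"
  assumes \<mu>: "premeasure \<mu>" and \<rho>: "ring_measure \<rho>" and sim: "similar \<rho> \<mu>"
  shows "associated_measure \<mu> = \<rho>"
  unfolding associated_measure_def
proof (rule the_equality)
  fix \<rho>' assume "ring_measure \<rho>' \<and> similar \<rho>' \<mu>"
  then have "ring_measure \<rho>'" "similar \<rho>' \<mu>"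
    by simp_all
  moreover from this have "similar \<rho>' \<rho>"
    using \<rho> similar_sym[OF sim] by - (rule similar_trans[OF _ \<mu>], simp_all add: ring_measure_def)
  ultimately show "\<rho>' = \<rho>"
    using \<rho> by (intro ring_measure_unique)
qed (use \<rho> sim in simp)

lemma associated_measure:
  fixes \<mu> :: "'x set \<rightharpoonup> 'a::{topological_ab_group_add, t2_space}"
  assumes "premeasure \<mu>"
  shows "ring_measure (associated_measure \<mu>)" "similar (associated_measure \<mu>) \<mu>"
  using associated_measure_eqI[OF assms ring_measure_maximal_extension[OF assms]]
    similar_maximal_extension[OF assms] ring_measure_maximal_extension[OF assms] by simp_all

text \<open>Reduces equations between associated measures to similarity of the underlying
  premeasures.\<close>

lemma associated_measure_similar_eq:
  fixes \<mu> :: "'x set \<rightharpoonup> 'a::{topological_ab_group_add, t2_space}"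
  assumes "premeasure \<mu>" "premeasure \<nu>" "similar \<mu> \<nu>"
  shows "associated_measure \<mu> = associated_measure \<nu>"
proof (rule associated_measure_eqI)
  have "premeasure (associated_measure \<nu>)"
    using associated_measure(1)[OF assms(2)] by (simp add: ring_measure_def)
  then show "similar (associated_measure \<nu>) \<mu>"
    using assms associated_measure(2)[OF assms(2)] by - (rule similar_trans[of _ \<nu>], simp_all add: similar_sym)
qed (use assms(1) associated_measure(1)[OF assms(2)] in simp_all)

lemma host_associated_measure:
  fixes \<mu> :: "'x set \<rightharpoonup> 'a::{topological_ab_group_add, t2_space}"
  shows "premeasure \<mu> \<Longrightarrow> host (associated_measure \<mu>) = host \<mu>"
  using associated_measure(2)[of \<mu>] by (simp add: similar_def)

subsection \<open>Pointwise operations\<close>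

lemma dom_pointwise_plus: "dom (pointwise_plus \<mu> \<nu>) = dom \<mu> \<inter> dom \<nu>"
  by (auto simp: pointwise_plus_def dom_def)

lemma dom_pointwise_minus: "dom (pointwise_minus \<mu>) = dom \<mu>"
  by (auto simp: pointwise_minus_def dom_def)

lemma host_pointwise_minus: "host (pointwise_minus \<mu>) = host \<mu>"
  by (simp add: host_def dom_pointwise_minus)

lemma host_pointwise_plus:
  assumes "premeasure \<mu>" "premeasure \<nu>" "host \<mu> = host \<nu>"
  shows "host (pointwise_plus \<mu> \<nu>) = host \<mu>"
  using assms hull_Int_delta_rings[OF assms(1,2)[THEN premeasure_delta_ring]]
  by (simp add: host_def dom_pointwise_plus)

lemma premeasure_pointwise_plus:
  assumes \<mu>: "premeasure \<mu>" and \<nu>: "premeasure \<nu>"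
  shows "premeasure (pointwise_plus \<mu> \<nu>)"
  unfolding premeasure_def dom_pointwise_plus
proof (intro conjI ballI allI impI)
  show "delta_ring (dom \<mu> \<inter> dom \<nu>)"
    using assms by (intro delta_ring_Int premeasure_delta_ring)
  fix A and I :: "nat set" and P
  assume A: "A \<in> dom \<mu> \<inter> dom \<nu>" and P: "partition_into (dom \<mu> \<inter> dom \<nu>) A I P"
  have "((\<lambda>i. the (\<mu> (P i)) + the (\<nu> (P i))) has_sum (the (\<mu> A) + the (\<nu> A))) I"
    using A partition_into_mono[OF P]
    by (intro has_sum_add premeasure_has_sum[OF \<mu>] premeasure_has_sum[OF \<nu>]) auto
  moreover have "P i \<in> dom \<mu> \<inter> dom \<nu>" if "i \<in> I" for i
    using P that by (auto simp: partition_into_def)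
  ultimately have "((\<lambda>i. the (pointwise_plus \<mu> \<nu> (P i))) has_sum (the (\<mu> A) + the (\<nu> A))) I"
    by (simp add: pointwise_plus_def cong: has_sum_cong)
  moreover have "the (pointwise_plus \<mu> \<nu> A) = the (\<mu> A) + the (\<nu> A)"
    using A by (simp add: pointwise_plus_def)
  ultimately show "((\<lambda>i. the (pointwise_plus \<mu> \<nu> (P i))) has_sum the (pointwise_plus \<mu> \<nu> A)) I"
    by simp
qed

lemma premeasure_pointwise_minus:
  fixes \<mu> :: "'x set \<rightharpoonup> 'a::{topological_ab_group_add, t2_space}"
  assumes \<mu>: "premeasure \<mu>"
  shows "premeasure (pointwise_minus \<mu>)"
  unfolding premeasure_def dom_pointwise_minus
proof (intro conjI ballI allI impI)
  show "delta_ring (dom \<mu>)"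
    using \<mu> by (rule premeasure_delta_ring)
  fix A and I :: "nat set" and P
  assume A: "A \<in> dom \<mu>" and P: "partition_into (dom \<mu>) A I P"
  have "((\<lambda>i. - the (\<mu> (P i))) has_sum (- the (\<mu> A))) I"
    using premeasure_has_sum[OF \<mu> A _ P] by (simp add: has_sum_uminus)
  moreover have "P i \<in> dom \<mu>" if "i \<in> I" for i
    using P that by (auto simp: partition_into_def)
  ultimately have "((\<lambda>i. the (pointwise_minus \<mu> (P i))) has_sum (- the (\<mu> A))) I"
    by (simp add: pointwise_minus_def cong: has_sum_cong)
  moreover have "the (pointwise_minus \<mu> A) = - the (\<mu> A)"
    using A by (simp add: pointwise_minus_def)
  ultimately show "((\<lambda>i. the (pointwise_minus \<mu> (P i))) has_sum the (pointwise_minus \<mu> A)) I"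
    by simp
qed

lemma pointwise_minus_minus:
  fixes \<mu> :: "'x set \<rightharpoonup> 'a::group_add"
  shows "pointwise_minus (pointwise_minus \<mu>) = \<mu>"
  by (rule ext) (auto simp: pointwise_minus_def dom_def)

lemma pointwise_minus_mono: "\<mu> \<subseteq>\<^sub>m \<nu> \<Longrightarrow> pointwise_minus \<mu> \<subseteq>\<^sub>m pointwise_minus \<nu>"
  by (auto simp: map_le_def pointwise_minus_def dom_def)

lemma similar_pointwise_minus:
  assumes "similar \<mu> \<nu>"
  shows "similar (pointwise_minus \<mu>) (pointwise_minus \<nu>)"
  unfolding similar_def host_pointwise_minus dom_pointwise_minus
  using assms by (simp add: similar_def pointwise_minus_def)

text \<open>Negation is an involution that preserves premeasures, similarity and extension, so
  maximality of \<open>\<mu>\<close> transfers to its negative.\<close>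

lemma ring_measure_pointwise_minus:
  fixes \<mu> :: "'x set \<rightharpoonup> 'a::{topological_ab_group_add, t2_space}"
  assumes \<mu>: "ring_measure \<mu>"
  shows "ring_measure (pointwise_minus \<mu>)"
  unfolding ring_measure_def
proof (intro conjI allI impI)
  show "premeasure (pointwise_minus \<mu>)"
    using \<mu> by (simp add: ring_measure_def premeasure_pointwise_minus)
  fix \<nu> assume "premeasure \<nu> \<and> similar \<nu> (pointwise_minus \<mu>)"
  then have "pointwise_minus \<nu> \<subseteq>\<^sub>m \<mu>"
    using \<mu> premeasure_pointwise_minus[of \<nu>] similar_pointwise_minus[of \<nu> "pointwise_minus \<mu>"]
    by (simp add: ring_measure_def pointwise_minus_minus)
  then show "\<nu> \<subseteq>\<^sub>m pointwise_minus \<mu>"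
    using pointwise_minus_mono pointwise_minus_minus by metis
qed

text \<open>The domain is already the whole host, so it contains the domain of every similar
  map.\<close>

lemma ring_measure_zero:
  assumes "sigma_ring Q"
  shows "ring_measure ((\<lambda>A. if A \<in> Q then Some 0 else None) :: 'x set \<rightharpoonup> 'a::{topological_comm_monoid_add, t2_space})"
      (is "ring_measure ?z")
    and "host (\<lambda>A. if A \<in> Q then Some (0::'a) else None) = Q"
proof -
  have dom: "dom ?z = Q"
    by (auto simp: dom_def)
  show host: "host ?z = Q"
    using assms unfolding host_def dom by (rule hull_same)
  have "premeasure ?z"
    unfolding premeasure_def dom
    using sigma_ring_imp_delta_ring[OF assms]
    by (auto intro!: has_sum_0 simp: partition_into_def image_subset_iff)
  moreover have "\<nu> \<subseteq>\<^sub>m ?z" if "similar \<nu> ?z" for \<nu>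
    using that dom_subset_host[of \<nu>] unfolding similar_def map_le_def host dom by blast
  ultimately show "ring_measure ?z"
    by (simp add: ring_measure_def)
qed

lemma pointwise_plus_mono:
  "\<mu> \<subseteq>\<^sub>m \<mu>' \<Longrightarrow> \<nu> \<subseteq>\<^sub>m \<nu>' \<Longrightarrow> pointwise_plus \<mu> \<nu> \<subseteq>\<^sub>m pointwise_plus \<mu>' \<nu>'"
  unfolding map_le_def pointwise_plus_def dom_def by auto

lemma pointwise_plus_commute:
  fixes \<mu> :: "'x set \<rightharpoonup> 'a::ab_semigroup_add"
  shows "pointwise_plus \<mu> \<nu> = pointwise_plus \<nu> \<mu>"
  by (rule ext) (simp add: pointwise_plus_def add.commute conj_commute)

lemma pointwise_plus_assoc:
  fixes \<mu> :: "'x set \<rightharpoonup> 'a::semigroup_add"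
  shows "pointwise_plus (pointwise_plus \<mu> \<nu>) \<rho> = pointwise_plus \<mu> (pointwise_plus \<nu> \<rho>)"
  by (rule ext) (simp add: pointwise_plus_def add.assoc dom_def)

section \<open>Sums of associated measures and the group laws\<close>

lemma associated_measure_ring_measure:
  assumes "ring_measure \<mu>"
  shows "associated_measure \<mu> = \<mu>"
  using assms by (intro associated_measure_eqI similar_refl) (auto simp: ring_measure_def)

text \<open>Enlarging \<open>\<mu>\<close> to its associated measure enlarges the pointwise sum
  without changing its host, so the two sums are similar. This removes the inner
  \<open>associated_measure\<close> from an iterated sum.\<close>

lemma associated_measure_plus_left:
  fixes \<mu> :: "'x set \<rightharpoonup> 'a::{topological_ab_group_add, t2_space}"
  assumes \<mu>: "premeasure \<mu>" and \<nu>: "premeasure \<nu>" and host: "host \<mu> = host \<nu>"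
  shows "associated_measure (pointwise_plus (associated_measure \<mu>) \<nu>) =
    associated_measure (pointwise_plus \<mu> \<nu>)"
proof (rule associated_measure_similar_eq)
  let ?\<rho> = "associated_measure \<mu>"
  have \<rho>: "ring_measure ?\<rho>" "premeasure ?\<rho>" "similar \<mu> ?\<rho>"
    using associated_measure[OF \<mu>] by (auto simp: ring_measure_def similar_sym)
  show "premeasure (pointwise_plus ?\<rho> \<nu>)" "premeasure (pointwise_plus \<mu> \<nu>)"
    using \<rho> \<mu> \<nu> by (auto intro: premeasure_pointwise_plus)
  have "\<mu> \<subseteq>\<^sub>m ?\<rho>"
    using \<rho> \<mu> by (simp add: ring_measure_def)
  then have "pointwise_plus \<mu> \<nu> \<subseteq>\<^sub>m pointwise_plus ?\<rho> \<nu>"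
    by (intro pointwise_plus_mono) auto
  then have "similar (pointwise_plus \<mu> \<nu>) (pointwise_plus ?\<rho> \<nu>)"
    using \<rho>(2) \<mu> \<nu> host by (intro map_le_similar) (simp_all add: host_pointwise_plus host_associated_measure)
  then show "similar (pointwise_plus ?\<rho> \<nu>) (pointwise_plus \<mu> \<nu>)"
    by (rule similar_sym)
qed

theorem theorem7p5:
  fixes Q :: "'x set set"
  assumes "sigma_ring Q"
  shows "comm_group (measure_monoid Q :: ('x set \<rightharpoonup> 'a::{topological_ab_group_add, t2_space}) monoid) \<and>
    (\<forall>\<mu> :: 'x set \<rightharpoonup> 'a. \<mu> \<in> carrier (measure_monoid Q) \<longrightarrow>
       inv\<^bsub>measure_monoid Q\<^esub> \<mu> = pointwise_minus \<mu>)"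
proof -
  let ?M = "measure_monoid Q :: ('x set \<rightharpoonup> 'a) monoid"
  let ?z = "\<lambda>A. if A \<in> Q then Some (0::'a) else None"
  have carrier: "\<mu> \<in> carrier ?M \<longleftrightarrow> ring_measure \<mu> \<and> host \<mu> = Q" for \<mu>
    by (simp add: measure_monoid_def)
  have pre: "premeasure \<mu>" if "\<mu> \<in> carrier ?M" for \<mu>
    using that by (simp add: carrier ring_measure_def)
  have mult: "\<mu> \<otimes>\<^bsub>?M\<^esub> \<nu> = associated_measure (pointwise_plus \<mu> \<nu>)" for \<mu> \<nu>
    by (simp add: measure_monoid_def)
  have one: "\<one>\<^bsub>?M\<^esub> = ?z"
    by (simp add: measure_monoid_def)
  have closed: "\<mu> \<otimes>\<^bsub>?M\<^esub> \<nu> \<in> carrier ?M" if "\<mu> \<in> carrier ?M" "\<nu> \<in> carrier ?M" for \<mu> \<nu>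
  proof -
    have "premeasure (pointwise_plus \<mu> \<nu>)" "host (pointwise_plus \<mu> \<nu>) = Q"
      using that pre by (auto simp: premeasure_pointwise_plus host_pointwise_plus carrier)
    then show ?thesis
      by (simp add: carrier mult associated_measure host_associated_measure)
  qed
  have comm: "\<mu> \<otimes>\<^bsub>?M\<^esub> \<nu> = \<nu> \<otimes>\<^bsub>?M\<^esub> \<mu>" for \<mu> \<nu>
    by (simp add: mult pointwise_plus_commute)
  have assoc_left: "\<mu> \<otimes>\<^bsub>?M\<^esub> \<nu> \<otimes>\<^bsub>?M\<^esub> \<rho> = associated_measure (pointwise_plus (pointwise_plus \<mu> \<nu>) \<rho>)"
    if "\<mu> \<in> carrier ?M" "\<nu> \<in> carrier ?M" "\<rho> \<in> carrier ?M" for \<mu> \<nu> \<rho>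
    using that pre unfolding mult carrier
    by (intro associated_measure_plus_left) (auto simp: premeasure_pointwise_plus host_pointwise_plus carrier)
  \<comment> \<open>Commutativity turns the right-hand side into a product bracketed to the left, so
    \<open>assoc_left\<close> applies to both sides and associativity of the pointwise sum
    remains.\<close>
  have assoc: "\<mu> \<otimes>\<^bsub>?M\<^esub> \<nu> \<otimes>\<^bsub>?M\<^esub> \<rho> = \<mu> \<otimes>\<^bsub>?M\<^esub> (\<nu> \<otimes>\<^bsub>?M\<^esub> \<rho>)"
    if "\<mu> \<in> carrier ?M" "\<nu> \<in> carrier ?M" "\<rho> \<in> carrier ?M" for \<mu> \<nu> \<rho>
    using assoc_left[OF that] assoc_left[OF that(2,3,1)] comm[of \<mu> "\<nu> \<otimes>\<^bsub>?M\<^esub> \<rho>"]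
    by (simp add: pointwise_plus_assoc pointwise_plus_commute[of \<mu> "pointwise_plus \<nu> \<rho>"])
  have z: "?z \<in> carrier ?M"
    using ring_measure_zero[OF assms, where 'a = 'a] by (simp add: carrier)
  have unit: "?z \<otimes>\<^bsub>?M\<^esub> \<mu> = \<mu>" if "\<mu> \<in> carrier ?M" for \<mu>
  proof -
    have "dom \<mu> \<subseteq> Q"
      using that dom_subset_host[of \<mu>] by (simp add: carrier)
    have "pointwise_plus ?z \<mu> A = \<mu> A" for A
      using \<open>dom \<mu> \<subseteq> Q\<close> by (cases "\<mu> A") (auto simp: pointwise_plus_def dom_def)
    then have "pointwise_plus ?z \<mu> = \<mu>" ..
    then show ?thesis
      using that by (simp add: mult associated_measure_ring_measure carrier)
  qed
  have minus: "pointwise_minus \<mu> \<in> carrier ?M" if "\<mu> \<in> carrier ?M" for \<mu>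
    using that by (simp add: carrier ring_measure_pointwise_minus host_pointwise_minus)
  \<comment> \<open>The pointwise sum is the zero map on \<open>dom \<mu>\<close> only, but its host
    is still \<open>Q\<close>. Hence it is similar to \<open>?z\<close>, which is a measure and
    therefore the associated one.\<close>
  have inverse: "pointwise_minus \<mu> \<otimes>\<^bsub>?M\<^esub> \<mu> = ?z" if "\<mu> \<in> carrier ?M" for \<mu>
    unfolding mult
  proof (rule associated_measure_eqI)
    let ?p = "pointwise_plus (pointwise_minus \<mu>) \<mu>"
    show "premeasure ?p"
      using that pre minus by (intro premeasure_pointwise_plus) auto
    have "host ?p = Q"
      using that pre minus by (subst host_pointwise_plus) (auto simp: carrier)
    moreover have "?p \<subseteq>\<^sub>m ?z"
      using that dom_subset_host[of \<mu>] unfolding carrier map_le_def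
      by (auto simp: pointwise_plus_def pointwise_minus_def dom_def split: if_splits)
    ultimately show "similar ?z ?p"
      using z by (intro similar_sym[OF map_le_similar]) (auto simp: carrier)
  qed (use z in \<open>simp add: carrier\<close>)
  have group: "comm_group ?M"
  proof (rule comm_groupI)
    fix \<mu> assume \<mu>: "\<mu> \<in> carrier ?M"
    show "\<exists>\<nu>\<in>carrier ?M. \<nu> \<otimes>\<^bsub>?M\<^esub> \<mu> = \<one>\<^bsub>?M\<^esub>"
      unfolding one using inverse[OF \<mu>] minus[OF \<mu>] by (rule bexI)
  qed (simp_all only: one closed z assoc unit, rule comm)
  moreover have "inv\<^bsub>?M\<^esub> \<mu> = pointwise_minus \<mu>" if "\<mu> \<in> carrier ?M" for \<mu>
    using group that inverse minus one
    by (intro group.inv_equality) (auto simp: comm_group_def)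
  ultimately show ?thesis
    by blast
qed

end
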